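(* Let $m\ge 1$, $\varepsilon>0$, and let $L\in GL(m,\mathbb{R})$ have all (complex) eigenvalues of modulus less than $1$. Let $A$ be the unique non-empty compact subset of $\mathbb{R}^m$ with $L_\varepsilon(A)=A$. Then the boundary $\partial A$ of $A$ is continuously differentiable, i.e. $\partial A$ is an $(m-1)$-dimensional $C^1$ submanifold of $\mathbb{R}^m$.
   Context: For a non-empty compact set $C\subset\mathbb{R}^m$, $L_\varepsilon(C)=\{x+y \mid x\in L(C),\ \|y\|\le\varepsilon\}$, where $\|\cdot\|$ is the Euclidean norm and $L(C)=\{L(x)\mid x\in C\}$. Under the eigenvalue assumption, $L_\varepsilon$ has exactly one fixed point among the non-empty compact subsets of $\mathbb{R}^m$; this fixed point is $A$. *)

theory Defs
  imports "HOL-Analysis.Analysis"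
begin

text \<open>The eigenvalues of a real square matrix in the complex sense, i.e. those of its
  entrywise complexification.\<close>

definition complex_eigenvalue :: "real^'m^'m \<Rightarrow> complex \<Rightarrow> bool" where
  "complex_eigenvalue L \<mu> \<longleftrightarrow>
     (\<exists>v :: complex^'m. v \<noteq> 0 \<and> map_matrix complex_of_real L *v v = \<mu> *s v)"

definition L_eps :: "real^'m^'m \<Rightarrow> real \<Rightarrow> (real^'m) set \<Rightarrow> (real^'m) set" where
  "L_eps L \<epsilon> C = {x + y | x y. x \<in> (\<lambda>v. L *v v) ` C \<and> norm y \<le> \<epsilon>}"

text \<open>Continuous differentiability on an open set: the Frechet derivative exists at every
  point and depends continuously on the point in the operator norm.\<close>

definition C1_on :: "('a::real_normed_vector \<Rightarrow> 'b::real_normed_vector) \<Rightarrow> 'a set \<Rightarrow> bool" where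
  "C1_on f U \<longleftrightarrow>
     (\<exists>f' :: 'a \<Rightarrow> 'a \<Rightarrow>\<^sub>L 'b.
        (\<forall>x\<in>U. (f has_derivative blinfun_apply (f' x)) (at x)) \<and> continuous_on U f')"

definition C1_diffeomorphism ::
    "'a::real_normed_vector set \<Rightarrow> 'a set \<Rightarrow> ('a \<Rightarrow> 'a) \<Rightarrow> ('a \<Rightarrow> 'a) \<Rightarrow> bool" where
  "C1_diffeomorphism U V \<phi> \<psi> \<longleftrightarrow>
     open U \<and> open V \<and> homeomorphism U V \<phi> \<psi> \<and> C1_on \<phi> U \<and> C1_on \<psi> V"

text \<open>Embedded submanifolds via local flattening charts of the ambient space. The model
  \<open>\<real>\<^sup>k \<times> {0}\<close> is an arbitrary \<open>k\<close>-dimensional linear subspace \<open>W\<close>, which avoids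
  a choice of coordinates.\<close>

definition C1_submanifold :: "nat \<Rightarrow> 'a::euclidean_space set \<Rightarrow> bool" where
  "C1_submanifold k S \<longleftrightarrow>
     (\<forall>p\<in>S. \<exists>U V \<phi> \<psi> W. p \<in> U \<and> C1_diffeomorphism U V \<phi> \<psi> \<and>
        subspace W \<and> dim W = k \<and> \<phi> ` (U \<inter> S) = V \<inter> W)"

end

theory Submission
  imports Defs
begin

text \<open>
  Put \<open>C = L(A)\<close>. The equation \<open>L\<^sub>\<epsilon>(A) = A\<close> says that \<open>A\<close> is the parallel body of \<open>C\<close> at
  distance \<open>\<epsilon>\<close>. If \<open>C\<close> is convex, the squared distance to \<open>C\<close> is a \<open>C\<^sup>1\<close> function: its gradient
  at \<open>x\<close> is \<open>2 (x - P x)\<close>, where \<open>P\<close> is the nearest-point map of \<open>C\<close>, which is \<open>1\<close>-Lipschitz.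
  On the level set of value \<open>\<epsilon>\<^sup>2\<close> this gradient has length \<open>2\<epsilon> > 0\<close>, so no point of the level set is
  interior to \<open>A\<close>. The level set is therefore exactly \<open>\<partial>A\<close>
  (\<open>C1_submanifold_frontier_parallel_body\<close>), and the inverse function theorem makes it a
  hypersurface (\<open>C1_submanifold_regular_level_set\<close>).

  It remains to see that \<open>A\<close>, hence \<open>C\<close>, is convex (\<open>minkowski_fixed_point_convex\<close>). Iterating
  the equation gives \<open>A = L\<^sup>n(A) + S\<close>, where \<open>S\<close> is the sum of the convex sets \<open>L\<^sup>k(B)\<close> for \<open>k < n\<close>
  and \<open>B\<close> is the ball of radius \<open>\<epsilon>\<close>. Once \<open>L\<^sup>n\<close> tends to \<open>0\<close>, the set \<open>A\<close> is convex up to an error that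
  vanishes as \<open>n\<close> grows, and it is closed. The decay of \<open>L\<^sup>n\<close> is read off from the boundedness of
  \<open>A\<close>: the sets \<open>S\<close> stay bounded as \<open>n\<close> grows, which forces the series of the absolute values of
  each coordinate of \<open>L\<^sup>k w\<close> to converge (\<open>minkowski_fixed_point_funpow_tendsto_0\<close>).
\<close>

section \<open>Regular level sets\<close>

definition rank_one :: "'a::real_inner \<Rightarrow> 'a \<Rightarrow> 'a \<Rightarrow>\<^sub>L 'a" where
  "rank_one a b = blinfun_scaleR_left b o\<^sub>L blinfun_inner_right a"

lemma rank_one_apply [simp]: "rank_one a b h = (a \<bullet> h) *\<^sub>R b"
  by (simp add: rank_one_def)

lemma continuous_on_rank_one [continuous_intros]:
  assumes "continuous_on S a"
  shows "continuous_on S (\<lambda>x. rank_one (a x) b)"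
  unfolding rank_one_def by (intro continuous_intros assms)

text \<open>
  Near a point \<open>p\<close> with unit normal \<open>n\<close>, the chart keeps the component of \<open>x\<close> orthogonal to \<open>n\<close> and
  replaces the component along \<open>n\<close> by \<open>f x - c\<close>, so the level set goes to the hyperplane
  orthogonal to \<open>n\<close>. The derivative of this chart is a rank-one perturbation of the identity.
  Its inverse is thus an explicit continuous function of the gradient, which yields the
  continuity of the derivative of the inverse chart.
\<close>

lemma C1_submanifold_regular_level_set:
  fixes f :: "'a::euclidean_space \<Rightarrow> real" and G :: "'a \<Rightarrow> 'a"
  assumes "open \<Omega>"
    and df: "\<And>x. x \<in> \<Omega> \<Longrightarrow> (f has_derivative (\<lambda>h. G x \<bullet> h)) (at x)"
    and contG: "continuous_on \<Omega> G"
    and regular: "\<And>x. x \<in> \<Omega> \<Longrightarrow> f x = c \<Longrightarrow> G x \<noteq> 0"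
  shows "C1_submanifold (DIM('a) - 1) {x \<in> \<Omega>. f x = c}"
  unfolding C1_submanifold_def
proof
  fix p assume "p \<in> {x \<in> \<Omega>. f x = c}"
  then have "p \<in> \<Omega>" and "G p \<noteq> 0"
    using regular by auto
  define n where "n = sgn (G p)"
  have nn [simp]: "n \<bullet> n = 1"
    using \<open>G p \<noteq> 0\<close> by (simp add: n_def norm_sgn flip: power2_norm_eq_inner)
  define \<phi> where "\<phi> = (\<lambda>x. x - (n \<bullet> x) *\<^sub>R n + (f x - c) *\<^sub>R n)"
  define \<phi>' where "\<phi>' = (\<lambda>x. id_blinfun - rank_one n n + rank_one (G x) n)"
  define \<kappa> where "\<kappa> = (\<lambda>x. id_blinfun + rank_one ((1 / (G x \<bullet> n)) *\<^sub>R (n - G x)) n)"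
  \<comment> \<open>\<open>\<phi>' x\<close> sends \<open>h\<close> to \<open>h - (n \<bullet> h) n + (G x \<bullet> h) n\<close>; solving for \<open>h\<close> gives \<open>\<kappa> x\<close> wherever
    \<open>G x \<bullet> n\<close> does not vanish.\<close>
  define U\<^sub>0 where "U\<^sub>0 = {x \<in> \<Omega>. G x \<bullet> n > 0}"
  have "open U\<^sub>0"
    unfolding U\<^sub>0_def
    using continuous_open_preimage[OF continuous_on_inner[OF contG continuous_on_const] \<open>open \<Omega>\<close>
        open_greaterThan[of 0], of n]
    by (simp add: vimage_def Int_def)
  have "p \<in> U\<^sub>0"
    using \<open>p \<in> \<Omega>\<close> \<open>G p \<noteq> 0\<close> by (simp add: U\<^sub>0_def n_def sgn_div_norm)
  have contG0: "continuous_on U\<^sub>0 G"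
    using contG by (rule continuous_on_subset) (auto simp: U\<^sub>0_def)
  have d\<phi>: "(\<phi> has_derivative blinfun_apply (\<phi>' x)) (at x)" if "x \<in> U\<^sub>0" for x
    using that unfolding \<phi>_def \<phi>'_def U\<^sub>0_def
    by (auto intro!: derivative_eq_intros df simp: blinfun.bilinear_simps fun_eq_iff)
  have cont\<phi>': "continuous_on U\<^sub>0 \<phi>'"
    unfolding \<phi>'_def by (intro continuous_intros contG0)
  have left: "\<kappa> x o\<^sub>L \<phi>' x = id_blinfun" if "x \<in> U\<^sub>0" for x
    using that unfolding \<kappa>_def \<phi>'_def U\<^sub>0_def
    by (intro blinfun_eqI)
       (simp add: blinfun.bilinear_simps algebra_simps inner_simps divide_simps flip: scaleR_add_left)
  have right: "\<phi>' x o\<^sub>L \<kappa> x = id_blinfun" if "x \<in> U\<^sub>0" for x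
    using that unfolding \<kappa>_def \<phi>'_def U\<^sub>0_def
    by (intro blinfun_eqI)
       (simp add: blinfun.bilinear_simps algebra_simps inner_simps divide_simps flip: scaleR_add_left)
  have inv: "inv (blinfun_apply (\<phi>' x)) = blinfun_apply (\<kappa> x)" if "x \<in> U\<^sub>0" for x
    by (intro inv_unique_comp)
       (simp_all add: left[OF that] right[OF that] fun_eq_iff flip: blinfun_apply_blinfun_compose)
  obtain U V \<psi> \<psi>' where "open U" "U \<subseteq> U\<^sub>0" "p \<in> U" "open V" and hom: "homeomorphism U V \<phi> \<psi>"
    and d\<psi>: "\<And>y. y \<in> V \<Longrightarrow> (\<psi> has_derivative \<psi>' y) (at y)"
    and \<psi>': "\<And>y. y \<in> V \<Longrightarrow> \<psi>' y = inv (blinfun_apply (\<phi>' (\<psi> y)))"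
    using inverse_function_theorem[OF \<open>open U\<^sub>0\<close> d\<phi> cont\<phi>' \<open>p \<in> U\<^sub>0\<close> left[OF \<open>p \<in> U\<^sub>0\<close>]] by metis
  have \<psi>_in: "\<psi> ` V \<subseteq> U\<^sub>0"
    using hom \<open>U \<subseteq> U\<^sub>0\<close> by (auto simp: homeomorphism_def)
  have "C1_on \<phi> U"
    unfolding C1_on_def using d\<phi> cont\<phi>' \<open>U \<subseteq> U\<^sub>0\<close> continuous_on_subset by blast
  moreover have "C1_on \<psi> V"
    unfolding C1_on_def
  proof (intro exI[of _ "\<lambda>y. \<kappa> (\<psi> y)"] conjI ballI)
    fix y assume "y \<in> V"
    then show "(\<psi> has_derivative blinfun_apply (\<kappa> (\<psi> y))) (at y)"
      using d\<psi>[of y] \<psi>'[of y] inv[of "\<psi> y"] \<psi>_in by auto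
  next
    have "continuous_on U\<^sub>0 \<kappa>"
      unfolding \<kappa>_def
      by (intro continuous_intros contG0) (auto simp: U\<^sub>0_def)
    then show "continuous_on V (\<lambda>y. \<kappa> (\<psi> y))"
      by (rule continuous_on_compose2) (use hom \<psi>_in in \<open>auto simp: homeomorphism_def\<close>)
  qed
  ultimately have "C1_diffeomorphism U V \<phi> \<psi>"
    by (simp add: C1_diffeomorphism_def \<open>open U\<close> \<open>open V\<close> hom)
  moreover have "\<phi> ` (U \<inter> {x \<in> \<Omega>. f x = c}) = V \<inter> {x. n \<bullet> x = 0}"
  proof -
    have "n \<bullet> \<phi> x = f x - c" for x
      by (simp add: \<phi>_def inner_simps)
    moreover have "V = \<phi> ` U" "U \<subseteq> \<Omega>"
      using hom \<open>U \<subseteq> U\<^sub>0\<close> by (auto simp: homeomorphism_def U\<^sub>0_def)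
    ultimately show ?thesis by auto
  qed
  moreover have "n \<noteq> 0" using nn by (metis inner_zero_left zero_neq_one)
  ultimately show "\<exists>U V \<phi> \<psi> W. p \<in> U \<and> C1_diffeomorphism U V \<phi> \<psi> \<and> subspace W \<and>
      dim W = DIM('a) - 1 \<and> \<phi> ` (U \<inter> {x \<in> \<Omega>. f x = c}) = V \<inter> W"
    using \<open>p \<in> U\<close> dim_hyperplane[of n] subspace_hyperplane[of n] by blast
qed

section \<open>Parallel bodies of convex sets\<close>

text \<open>
  The squared distance is an infimum of the functions \<open>\<lambda>z. (norm (z - w))\<^sup>2\<close> with \<open>w \<in> C\<close>.
  Comparing its value at \<open>y\<close> with the function for \<open>w = P x\<close>, and its value at \<open>x\<close> with the
  function for \<open>w = P y\<close>, bounds the error of the linear approximation from both sides. As \<open>P\<close>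
  is \<open>1\<close>-Lipschitz, both bounds are at most \<open>(norm (y - x))\<^sup>2\<close>.
\<close>

lemma has_derivative_sq_norm_diff_closest_point:
  fixes C :: "'a::euclidean_space set"
  assumes "convex C" "closed C" "C \<noteq> {}"
  shows "((\<lambda>x. (norm (x - closest_point C x))\<^sup>2) has_derivative
          (\<lambda>h. (2 *\<^sub>R (x - closest_point C x)) \<bullet> h)) (at x)"
proof -
  let ?P = "closest_point C" and ?f = "\<lambda>x. (norm (x - closest_point C x))\<^sup>2"
  have le: "?f z \<le> (norm (z - ?P w))\<^sup>2" for z w
    using closest_point_le[OF \<open>closed C\<close>] closest_point_in_set[OF assms(2,3)]
    by (intro power_mono) (auto simp: dist_norm)
  have bound: "\<bar>?f y - ?f x - (2 *\<^sub>R (x - ?P x)) \<bullet> (y - x)\<bar> \<le> (norm (y - x))\<^sup>2" for y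
  proof -
    have "?f y \<le> (norm ((x - ?P x) + (y - x)))\<^sup>2"
      using le[of y x] by simp
    then have upper: "?f y - ?f x - (2 *\<^sub>R (x - ?P x)) \<bullet> (y - x) \<le> (norm (y - x))\<^sup>2"
      by (simp add: power2_norm_eq_inner inner_simps inner_commute algebra_simps)
    have "?f x \<le> (norm ((y - ?P y) - (y - x)))\<^sup>2"
      using le[of x y] by simp
    then have "?f y - ?f x \<ge> 2 * ((y - ?P y) \<bullet> (y - x)) - (norm (y - x))\<^sup>2"
      by (simp add: power2_norm_eq_inner inner_simps inner_commute algebra_simps)
    moreover have "(y - ?P y) \<bullet> (y - x)
        = (x - ?P x) \<bullet> (y - x) + (norm (y - x))\<^sup>2 - (?P y - ?P x) \<bullet> (y - x)"
      by (simp add: power2_norm_eq_inner inner_simps inner_commute algebra_simps)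
    moreover have "(?P y - ?P x) \<bullet> (y - x) \<le> (norm (y - x))\<^sup>2"
    proof -
      have "(?P y - ?P x) \<bullet> (y - x) \<le> norm (?P y - ?P x) * norm (y - x)"
        by (rule norm_cauchy_schwarz)
      also have "\<dots> \<le> norm (y - x) * norm (y - x)"
        using closest_point_lipschitz[OF assms, of y x]
        by (intro mult_right_mono) (auto simp: dist_norm)
      finally show ?thesis by (simp add: power2_eq_square)
    qed
    ultimately show ?thesis using upper by simp
  qed
  show ?thesis
    unfolding has_derivative_at_alt
  proof (intro conjI allI impI)
    show "bounded_linear (\<lambda>h. (2 *\<^sub>R (x - ?P x)) \<bullet> h)"
      by (rule bounded_linear_inner_right)
    fix e :: real assume "e > 0"
    have "norm (?f y - ?f x - (2 *\<^sub>R (x - ?P x)) \<bullet> (y - x)) \<le> e * norm (y - x)"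
      if "norm (y - x) < e" for y
    proof -
      have "(norm (y - x))\<^sup>2 \<le> e * norm (y - x)"
        unfolding power2_eq_square using that by (intro mult_right_mono) auto
      with bound[of y] show ?thesis by (simp only: real_norm_def)
    qed
    with \<open>e > 0\<close> show "\<exists>d>0. \<forall>y. norm (y - x) < d \<longrightarrow>
        norm (?f y - ?f x - (2 *\<^sub>R (x - ?P x)) \<bullet> (y - x)) \<le> e * norm (y - x)"
      by blast
  qed
qed

lemma C1_submanifold_frontier_parallel_body:
  fixes C :: "'a::euclidean_space set"
  assumes "convex C" "closed C" "C \<noteq> {}" "\<epsilon> > 0"
  shows "C1_submanifold (DIM('a) - 1) (frontier {x + y | x y. x \<in> C \<and> norm y \<le> \<epsilon>})"
proof -
  define f where "f = (\<lambda>x. (norm (x - closest_point C x))\<^sup>2)"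
  define G where "G = (\<lambda>x. 2 *\<^sub>R (x - closest_point C x))"
  have df: "(f has_derivative (\<lambda>h. G x \<bullet> h)) (at x)" for x
    unfolding f_def G_def by (rule has_derivative_sq_norm_diff_closest_point[OF assms(1-3)])
  have contf: "continuous_on UNIV f"
    using df has_derivative_continuous by (blast intro: continuous_at_imp_continuous_on)
  have contG: "continuous_on UNIV G"
    unfolding G_def by (intro continuous_intros continuous_on_closest_point assms)
  have regular: "G x \<noteq> 0" if "f x = \<epsilon>\<^sup>2" for x
    using that \<open>\<epsilon> > 0\<close> by (auto simp: f_def G_def)
  let ?B = "{x + y | x y. x \<in> C \<and> norm y \<le> \<epsilon>}"
  have B: "?B = {x. f x \<le> \<epsilon>\<^sup>2}"
  proof (intro equalityI subsetI)
    fix z assume "z \<in> ?B"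
    then obtain x y where z: "z = x + y" "x \<in> C" "norm y \<le> \<epsilon>" by auto
    then have "norm (z - closest_point C z) \<le> \<epsilon>"
      using closest_point_le[OF \<open>closed C\<close> \<open>x \<in> C\<close>, of z] by (simp add: dist_norm)
    then show "z \<in> {x. f x \<le> \<epsilon>\<^sup>2}"
      by (simp add: f_def power_mono)
  next
    fix z assume "z \<in> {x. f x \<le> \<epsilon>\<^sup>2}"
    then have "norm (z - closest_point C z) \<le> \<epsilon>"
      using \<open>\<epsilon> > 0\<close> by (auto simp: f_def intro: power2_le_imp_le)
    then show "z \<in> ?B"
      using closest_point_in_set[OF assms(2,3), of z]
      by (intro CollectI exI[of _ "closest_point C z"] exI[of _ "z - closest_point C z"]) simp
  qed
  have "frontier ?B = {x. f x = \<epsilon>\<^sup>2}"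
  proof -
    have "closed {x. f x \<le> \<epsilon>\<^sup>2}"
      using contf by (intro closed_Collect_le continuous_intros)
    moreover have "{x. f x < \<epsilon>\<^sup>2} \<subseteq> interior {x. f x \<le> \<epsilon>\<^sup>2}"
      using contf by (intro interior_maximal open_Collect_less continuous_intros) auto
    \<comment> \<open>At an interior point of the body, \<open>f\<close> would have a local maximum, against \<open>regular\<close>.\<close>
    moreover have "x \<notin> interior {x. f x \<le> \<epsilon>\<^sup>2}" if "f x = \<epsilon>\<^sup>2" for x
    proof
      assume "x \<in> interior {x. f x \<le> \<epsilon>\<^sup>2}"
      moreover have "\<forall>y \<in> interior {x. f x \<le> \<epsilon>\<^sup>2}. f y \<le> f x"
        using that interior_subset by fastforce
      ultimately have "(\<lambda>h. G x \<bullet> h) = (\<lambda>h. 0)"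
        using differential_zero_maxmin[OF _ open_interior df] by blast
      then have "G x \<bullet> G x = 0" by meson
      then show False using regular[OF that] by simp
    qed
    ultimately show ?thesis
      unfolding B frontier_def using interior_subset[of "{x. f x \<le> \<epsilon>\<^sup>2}"] by force
  qed
  then show ?thesis
    using C1_submanifold_regular_level_set[of UNIV f G "\<epsilon>\<^sup>2"] df contG regular by simp
qed

section \<open>Convexity of the attractor\<close>

lemma linear_funpow:
  fixes f :: "'a::real_vector \<Rightarrow> 'a"
  assumes "linear f"
  shows "linear (f ^^ n)"
proof (induction n)
  case (Suc n)
  then show ?case using linear_compose[OF Suc assms] by (simp add: o_def)
qed (simp add: linear_ident id_def)

lemma minkowski_fixed_point_unfold:
  fixes f :: "'a::real_normed_vector \<Rightarrow> 'a"
  assumes lin: "linear f"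
    and A: "{x + y | x y. x \<in> f ` A \<and> norm y \<le> \<epsilon>} = A" and "\<epsilon> \<ge> 0"
  shows "A = {(f ^^ n) a + (\<Sum>k<n. (f ^^ k) (y k)) | a y. a \<in> A \<and> (\<forall>k. norm (y k) \<le> \<epsilon>)}"
proof (induction n)
  case 0
  have "\<exists>y::nat \<Rightarrow> 'a. \<forall>k. norm (y k) \<le> \<epsilon>"
    using \<open>\<epsilon> \<ge> 0\<close> by (intro exI[of _ "\<lambda>_. 0"]) simp
  then show ?case by simp
next
  case (Suc n)
  have split: "(f ^^ n) (f a + z) + s = (f ^^ Suc n) a + (s + (f ^^ n) z)" for a z s
    using linear_add[OF linear_funpow[OF lin]] by (simp add: funpow_swap1)
  show ?case
  proof (intro equalityI subsetI)
    fix x assume "x \<in> A"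
    then obtain a y where a: "a \<in> A" and y: "\<forall>k. norm (y k) \<le> \<epsilon>"
      and x: "x = (f ^^ n) a + (\<Sum>k<n. (f ^^ k) (y k))"
      using Suc by blast
    obtain a' z where a': "a' \<in> A" and z: "norm z \<le> \<epsilon>" and "a = f a' + z"
      using a A by blast
    then have "x = (f ^^ Suc n) a' + (\<Sum>k<Suc n. (f ^^ k) ((y(n := z)) k))"
      using x split by simp
    moreover have "\<forall>k. norm ((y(n := z)) k) \<le> \<epsilon>"
      using y z by simp
    ultimately show "x \<in> {(f ^^ Suc n) a + (\<Sum>k<Suc n. (f ^^ k) (y k)) | a y.
        a \<in> A \<and> (\<forall>k. norm (y k) \<le> \<epsilon>)}"
      using a' by blast
  next
    fix x assume "x \<in> {(f ^^ Suc n) a + (\<Sum>k<Suc n. (f ^^ k) (y k)) | a y.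
        a \<in> A \<and> (\<forall>k. norm (y k) \<le> \<epsilon>)}"
    then obtain a y where a: "a \<in> A" and y: "\<forall>k. norm (y k) \<le> \<epsilon>"
      and "x = (f ^^ Suc n) a + (\<Sum>k<Suc n. (f ^^ k) (y k))"
      by blast
    then have "x = (f ^^ n) (f a + y n) + (\<Sum>k<n. (f ^^ k) (y k))"
      using split by simp
    moreover have "f a + y n \<in> A"
      using a y A by blast
    ultimately show "x \<in> A"
      using y by (subst Suc) blast
  qed
qed

text \<open>
  For a vector \<open>w\<close> of norm at most \<open>\<epsilon>\<close>, all sums of the vectors \<open>f\<^sup>k w\<close> with arbitrary signs lie,
  up to a translation by \<open>f\<^sup>n a\<close>, in the bounded set \<open>A\<close>. As the opposite choice of signs is
  also allowed, the translation cancels and the signed sums themselves are bounded. With the signs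
  adapted to one coordinate, that coordinate of \<open>f\<^sup>k w\<close> is absolutely summable over \<open>k\<close>.
\<close>

lemma minkowski_fixed_point_funpow_tendsto_0:
  fixes f :: "'a::euclidean_space \<Rightarrow> 'a"
  assumes lin: "linear f"
    and A: "{x + y | x y. x \<in> f ` A \<and> norm y \<le> \<epsilon>} = A" and "\<epsilon> > 0"
    and "bounded A" "A \<noteq> {}"
  shows "(\<lambda>n. (f ^^ n) v) \<longlonglongrightarrow> 0"
proof -
  interpret fn: linear "f ^^ n" for n by (rule linear_funpow[OF lin])
  obtain M where M: "\<And>x. x \<in> A \<Longrightarrow> norm x \<le> M"
    using \<open>bounded A\<close> by (auto simp: bounded_iff)
  obtain a where "a \<in> A" using \<open>A \<noteq> {}\<close> by blast
  have in_A: "(f ^^ n) a + (\<Sum>k<n. (f ^^ k) (y k)) \<in> A" if "\<forall>k. norm (y k) \<le> \<epsilon>" for y n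
    using minkowski_fixed_point_unfold[OF lin A less_imp_le[OF \<open>\<epsilon> > 0\<close>], of n] \<open>a \<in> A\<close> that
    by blast
  define w where "w = \<epsilon> *\<^sub>R sgn v"
  have v: "v = (norm v / \<epsilon>) *\<^sub>R w"
    using \<open>\<epsilon> > 0\<close> by (cases "v = 0") (simp_all add: w_def sgn_div_norm)
  have w: "norm w \<le> \<epsilon>"
    using \<open>\<epsilon> > 0\<close> by (simp add: w_def norm_sgn)
  have "(\<lambda>n. (f ^^ n) w \<bullet> b) \<longlonglongrightarrow> 0" if b: "b \<in> Basis" for b
  proof -
    have "(\<Sum>k<n. \<bar>(f ^^ k) w \<bullet> b\<bar>) \<le> M" for n
    proof -
      define y where "y = (\<lambda>k. sgn ((f ^^ k) w \<bullet> b) *\<^sub>R w)"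
      have y: "norm (y k) \<le> \<epsilon>" for k
        using w \<open>\<epsilon> > 0\<close> by (simp add: y_def sgn_if)
      let ?s = "\<Sum>k<n. (f ^^ k) (y k)"
      have "norm ((f ^^ n) a + ?s) \<le> M" "norm ((f ^^ n) a - ?s) \<le> M"
        using M[OF in_A[of y n]] M[OF in_A[of "\<lambda>k. - y k" n]] y by (simp_all add: fn.neg sum_negf)
      then have "\<bar>((f ^^ n) a + ?s) \<bullet> b\<bar> \<le> M" "\<bar>((f ^^ n) a - ?s) \<bullet> b\<bar> \<le> M"
        using Basis_le_norm[OF b] order_trans by blast+
      then have "?s \<bullet> b \<le> M"
        by (simp add: inner_simps)
      moreover have "?s \<bullet> b = (\<Sum>k<n. \<bar>(f ^^ k) w \<bullet> b\<bar>)"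
        by (simp add: y_def fn.scale inner_sum_left abs_sgn mult.commute)
      ultimately show ?thesis by simp
    qed
    then have "summable (\<lambda>k. \<bar>(f ^^ k) w \<bullet> b\<bar>)"
      by (intro summableI_nonneg_bounded) auto
    then show ?thesis
      by (rule summable_LIMSEQ_zero[OF summable_rabs_cancel])
  qed
  then have "(\<lambda>n. (f ^^ n) w) \<longlonglongrightarrow> 0"
    by (subst tendsto_componentwise_iff) simp
  then have "(\<lambda>n. (norm v / \<epsilon>) *\<^sub>R (f ^^ n) w) \<longlonglongrightarrow> (norm v / \<epsilon>) *\<^sub>R 0"
    by (intro tendsto_intros)
  then show ?thesis
    by (subst v) (simp add: fn.scale)
qed

text \<open>
  Expand two points of \<open>A\<close> to depth \<open>n\<close> and combine their ball components convexly, but keep the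
  end point \<open>a\<close> of the first. The result lies in \<open>A\<close> and differs from the convex combination
  only by a multiple of \<open>f\<^sup>n (c - a)\<close> with \<open>a, c \<in> A\<close>, which is uniformly small.
\<close>

lemma minkowski_fixed_point_convex:
  fixes f :: "'a::euclidean_space \<Rightarrow> 'a"
  assumes lin: "linear f"
    and A: "{x + y | x y. x \<in> f ` A \<and> norm y \<le> \<epsilon>} = A" and "\<epsilon> > 0"
    and "compact A"
  shows "convex A"
proof (cases "A = {}")
  case False
  interpret fn: linear "f ^^ n" for n by (rule linear_funpow[OF lin])
  have "bounded A" "closed A"
    using \<open>compact A\<close> by (simp_all add: compact_imp_bounded compact_imp_closed)
  obtain D where D: "\<And>x y. x \<in> A \<Longrightarrow> y \<in> A \<Longrightarrow> norm (x - y) \<le> D"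
    using \<open>bounded A\<close> by (metis bounded_two_points dist_norm)
  note unfold = minkowski_fixed_point_unfold[OF lin A less_imp_le[OF \<open>\<epsilon> > 0\<close>]]
  have in_A: "(f ^^ n) a + (\<Sum>k<n. (f ^^ k) (y k)) \<in> A"
    if "a \<in> A" "\<forall>k. norm (y k) \<le> \<epsilon>" for a y n
    using unfold[of n] that by blast
  \<comment> \<open>The points \<open>a\<close>, \<open>c\<close> depend on \<open>n\<close>, so pointwise decay is turned into a bound on the
    operator norm of \<open>f\<^sup>n\<close> through its values on the basis.\<close>
  have norm_fn: "norm ((f ^^ n) v) \<le> (\<Sum>b\<in>Basis. norm ((f ^^ n) b)) * norm v" for n v
  proof -
    have "norm ((f ^^ n) v) = norm (\<Sum>b\<in>Basis. (v \<bullet> b) *\<^sub>R (f ^^ n) b)"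
      by (subst euclidean_representation[symmetric, of v]) (simp only: fn.sum fn.scale)
    also have "\<dots> \<le> (\<Sum>b\<in>Basis. norm v * norm ((f ^^ n) b))"
      by (intro order_trans[OF norm_sum] sum_mono) (simp add: Basis_le_norm mult_right_mono)
    finally show ?thesis by (simp add: sum_distrib_left mult.commute)
  qed
  have lim: "(\<lambda>n. (\<Sum>b\<in>Basis. norm ((f ^^ n) b)) * D) \<longlonglongrightarrow> (\<Sum>b\<in>(Basis::'a set). 0) * D"
    using minkowski_fixed_point_funpow_tendsto_0[OF lin A \<open>\<epsilon> > 0\<close> \<open>bounded A\<close> False]
    by (intro tendsto_intros tendsto_norm_zero)
  show ?thesis
  proof (rule convexI)
    fix x z and u v :: real
    assume x: "x \<in> A" and z: "z \<in> A" and uv: "0 \<le> u" "0 \<le> v" "u + v = 1"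
    have "\<exists>w\<in>A. dist w (u *\<^sub>R x + v *\<^sub>R z) < e" if "e > 0" for e
    proof -
      obtain n where n: "(\<Sum>b\<in>Basis. norm ((f ^^ n) b)) * D < e"
        using order_tendstoD(2)[OF lim, of e] \<open>e > 0\<close> by (auto simp: eventually_sequentially)
      obtain a p where a: "a \<in> A" and p: "\<forall>k. norm (p k) \<le> \<epsilon>"
        and x_eq: "x = (f ^^ n) a + (\<Sum>k<n. (f ^^ k) (p k))"
        using x unfold[of n] by blast
      obtain c q where c: "c \<in> A" and q: "\<forall>k. norm (q k) \<le> \<epsilon>"
        and z_eq: "z = (f ^^ n) c + (\<Sum>k<n. (f ^^ k) (q k))"
        using z unfold[of n] by blast
      define w where "w = (f ^^ n) a + (\<Sum>k<n. (f ^^ k) (u *\<^sub>R p k + v *\<^sub>R q k))"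
      have "norm (u *\<^sub>R p k + v *\<^sub>R q k) \<le> \<epsilon>" for k
        using convexD[OF convex_cball[of 0 \<epsilon>] _ _ uv, of "p k" "q k"] p q by simp
      then have "w \<in> A"
        unfolding w_def using a by (intro in_A) auto
      have "u *\<^sub>R x + v *\<^sub>R z - w = u *\<^sub>R (f ^^ n) a + v *\<^sub>R (f ^^ n) c - (u + v) *\<^sub>R (f ^^ n) a"
        unfolding x_eq z_eq w_def uv(3)
        by (simp add: fn.add fn.scale sum.distrib scaleR_sum_right algebra_simps)
      also have "\<dots> = v *\<^sub>R (f ^^ n) (c - a)"
        by (simp add: fn.diff algebra_simps)
      finally have "norm (u *\<^sub>R x + v *\<^sub>R z - w) \<le> norm ((f ^^ n) (c - a))"
        using uv by (simp add: mult_left_le_one_le)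
      also have "\<dots> \<le> (\<Sum>b\<in>Basis. norm ((f ^^ n) b)) * norm (c - a)"
        by (rule norm_fn)
      also have "\<dots> \<le> (\<Sum>b\<in>Basis. norm ((f ^^ n) b)) * D"
        using D[OF c a] by (intro mult_left_mono sum_nonneg) auto
      finally show ?thesis
        using n \<open>w \<in> A\<close> by (intro bexI[of _ w]) (simp_all add: dist_norm norm_minus_commute)
    qed
    then show "u *\<^sub>R x + v *\<^sub>R z \<in> A"
      using closed_approachable[OF \<open>closed A\<close>] by blast
  qed
qed simp

section \<open>The boundary of the attractor\<close>

theorem proposition3p2:
  fixes L :: "real^'m^'m" and \<epsilon> :: real and A :: "(real^'m) set"
  assumes "\<epsilon> > 0"
    and "invertible L"
    and "\<And>\<mu>. complex_eigenvalue L \<mu> \<Longrightarrow> cmod \<mu> < 1"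
    and "compact A" and "A \<noteq> {}" and "L_eps L \<epsilon> A = A"
  shows "C1_submanifold (CARD('m) - 1) (frontier A)"
proof -
  let ?f = "\<lambda>v. L *v v"
  have lin: "linear ?f" by (rule matrix_vector_mul_linear)
  have A: "{x + y | x y. x \<in> ?f ` A \<and> norm y \<le> \<epsilon>} = A"
    using \<open>L_eps L \<epsilon> A = A\<close> by (simp only: L_eps_def)
  have "convex A"
    by (rule minkowski_fixed_point_convex[OF lin A \<open>\<epsilon> > 0\<close> \<open>compact A\<close>])
  then have "convex (?f ` A)"
    by (rule convex_linear_image[OF lin])
  moreover have "closed (?f ` A)"
    using \<open>compact A\<close> lin
    by (intro compact_imp_closed compact_continuous_image linear_continuous_on) 
       (simp_all add: linear_conv_bounded_linear)
  ultimately have "C1_submanifold (DIM(real^'m) - 1)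
      (frontier {x + y | x y. x \<in> ?f ` A \<and> norm y \<le> \<epsilon>})"
    using \<open>A \<noteq> {}\<close> \<open>\<epsilon> > 0\<close> by (intro C1_submanifold_frontier_parallel_body) auto
  then show ?thesis
    unfolding A by simp
qed

end
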